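(* For $2\le n\le 4$, $\gamma_n=\frac{3}{4}\pi$.
   Context: $\mathcal{P}_n$ is the cone of $n\times n$ real positive semidefinite matrices, $\mathcal{N}_n$ the cone of $n\times n$ real symmetric entrywise nonnegative matrices. $\langle A,B\rangle=\operatorname{Tr}(AB)$ with Frobenius norm; $\angle(A,B)=\arccos\frac{\langle A,B\rangle}{\|A\|\|B\|}$ for nonzero $A,B$. $\gamma_n=\max\{\angle(X,Y): 0\ne X\in\mathcal{P}_n,\ 0\ne Y\in\mathcal{N}_n\}$. *)

theory Defs
  imports "HOL-Analysis.Analysis"
begin

definition psd_cone :: "(real^'n^'n) set" where
  "psd_cone = {X. transpose X = X \<and> (\<forall>x. 0 \<le> x \<bullet> (X *v x))}"

definition nonneg_cone :: "(real^'n^'n) set" where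
  "nonneg_cone = {Y. transpose Y = Y \<and> (\<forall>i j. 0 \<le> Y $ i $ j)}"

text \<open>The library norm on \<open>real^'n^'n\<close> is the Frobenius norm. As in the usual notation,
  the inner product is the trace of the product; on symmetric matrices it agrees with the
  library inner product (\<open>trace_eq_inner\<close> below). The angle is meaningful only for nonzero
  symmetric arguments.\<close>

definition mat_angle :: "real^'n^'n \<Rightarrow> real^'n^'n \<Rightarrow> real" where
  "mat_angle A B = arccos (trace (A ** B) / (norm A * norm B))"

definition cone_angles :: "'n::finite itself \<Rightarrow> real set" where
  "cone_angles _ =
     {mat_angle X Y | X Y :: real^'n^'n. X \<in> psd_cone \<and> X \<noteq> 0 \<and> Y \<in> nonneg_cone \<and> Y \<noteq> 0}"

text \<open>The order of the matrices is \<open>CARD('n)\<close>. The maximum is a genuine maximum, not a supremum;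
  that it exists is \<open>gamma_is_max\<close> below.\<close>

definition gamma :: "'n::finite itself \<Rightarrow> real" where
  "gamma N = (GREATEST a. a \<in> cone_angles N)"

lemma trace_eq_inner:
  fixes A B :: "real^'n^'n"
  assumes "transpose B = B"
  shows "trace (A ** B) = A \<bullet> B"
proof -
  have "B $ j $ i = B $ i $ j" for i j
    using assms by (metis transpose_def vec_lambda_beta)
  then show ?thesis
    by (simp add: trace_def matrix_matrix_mult_def inner_vec_def)
qed

lemma closed_psd_cone: "closed (psd_cone :: (real^'n^'n) set)"
proof -
  have "closed {X :: real^'n^'n. transpose X = X}"
    unfolding transpose_def by (intro closed_Collect_eq continuous_intros)
  moreover have "closed {X :: real^'n^'n. \<forall>x. 0 \<le> x \<bullet> (X *v x)}"
    unfolding matrix_vector_mult_def inner_vec_def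
    by (intro closed_Collect_all closed_Collect_le continuous_intros)
  ultimately show ?thesis
    unfolding psd_cone_def Collect_conj_eq by (rule closed_Int)
qed

lemma closed_nonneg_cone: "closed (nonneg_cone :: (real^'n^'n) set)"
proof -
  have "closed {X :: real^'n^'n. transpose X = X}"
    unfolding transpose_def by (intro closed_Collect_eq continuous_intros)
  moreover have "closed {X :: real^'n^'n. \<forall>i j. 0 \<le> X $ i $ j}"
    by (intro closed_Collect_all closed_Collect_le continuous_intros)
  ultimately show ?thesis
    unfolding nonneg_cone_def Collect_conj_eq by (rule closed_Int)
qed

lemma transpose_scale: "transpose (c *\<^sub>R X) = c *\<^sub>R transpose (X :: real^'n^'n)"
  by (simp add: transpose_def vec_eq_iff)

lemma scale_psd_cone: "X \<in> psd_cone \<Longrightarrow> 0 \<le> c \<Longrightarrow> c *\<^sub>R X \<in> psd_cone"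
  by (simp add: psd_cone_def transpose_scale scaleR_matrix_vector_assoc[symmetric])

lemma scale_nonneg_cone: "Y \<in> nonneg_cone \<Longrightarrow> 0 \<le> c \<Longrightarrow> c *\<^sub>R Y \<in> nonneg_cone"
  by (simp add: nonneg_cone_def transpose_scale)

lemma mat_1_nonzero: "(mat 1 :: real^'n^'n) \<noteq> 0"
  by (simp add: vec_eq_iff mat_def)

lemma ex_max_cone_angle:
  "\<exists>a\<in>cone_angles TYPE('n::finite). \<forall>b\<in>cone_angles TYPE('n). b \<le> a"
proof -
  define K where "K = (psd_cone \<inter> sphere (0 :: real^'n^'n) 1) \<times> (nonneg_cone \<inter> sphere (0 :: real^'n^'n) 1)"
  define f where "f = (\<lambda>p :: (real^'n^'n) \<times> (real^'n^'n). arccos (fst p \<bullet> snd p))"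
  have normalize: "\<exists>p\<in>K. mat_angle X Y = f p"
    if "X \<in> psd_cone" "X \<noteq> 0" "Y \<in> nonneg_cone" "Y \<noteq> 0" for X Y :: "real^'n^'n"
  proof
    let ?p = "(inverse (norm X) *\<^sub>R X, inverse (norm Y) *\<^sub>R Y)"
    show "?p \<in> K"
      using that by (simp add: K_def scale_psd_cone scale_nonneg_cone)
    have "transpose Y = Y"
      using that by (simp add: nonneg_cone_def)
    then show "mat_angle X Y = f ?p"
      by (simp add: mat_angle_def f_def trace_eq_inner field_simps)
  qed
  have attained: "f p \<in> cone_angles TYPE('n)" if "p \<in> K" for p
  proof -
    obtain X Y where p: "p = (X, Y)" by (cases p)
    have XY: "X \<in> psd_cone" "Y \<in> nonneg_cone" "norm X = 1" "norm Y = 1"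
      using that by (auto simp: K_def p)
    then have "transpose Y = Y"
      by (simp add: nonneg_cone_def)
    then have "f p = mat_angle X Y"
      using XY by (simp add: mat_angle_def f_def p trace_eq_inner)
    moreover have "X \<noteq> 0" "Y \<noteq> 0"
      using XY by auto
    ultimately show ?thesis
      using XY unfolding cone_angles_def by blast
  qed
  have "(mat 1 :: real^'n^'n) \<in> psd_cone" "(mat 1 :: real^'n^'n) \<in> nonneg_cone"
    by (simp add: psd_cone_def transpose_mat) (simp add: nonneg_cone_def transpose_mat, simp add: mat_def)
  then have "K \<noteq> {}"
    using normalize mat_1_nonzero by blast
  moreover have "compact K"
    unfolding K_def
    by (intro compact_Times closed_Int_compact closed_psd_cone closed_nonneg_cone compact_sphere)
  moreover have "continuous_on K f"
    unfolding f_def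
  proof (intro continuous_intros ballI)
    fix p assume "p \<in> K"
    then have "\<bar>fst p \<bullet> snd p\<bar> \<le> 1"
      using Cauchy_Schwarz_ineq2[of "fst p" "snd p"] by (auto simp: K_def)
    then show "- 1 \<le> fst p \<bullet> snd p \<and> fst p \<bullet> snd p \<le> 1"
      by auto
  qed
  ultimately obtain p where p: "p \<in> K" "\<forall>q\<in>K. f q \<le> f p"
    using continuous_attains_sup by blast
  have "b \<le> f p" if "b \<in> cone_angles TYPE('n)" for b
    using that normalize p(2) unfolding cone_angles_def by force
  then show ?thesis
    using attained p(1) by blast
qed

lemma gamma_is_max:
  "gamma TYPE('n::finite) \<in> cone_angles TYPE('n)"
  "b \<in> cone_angles TYPE('n) \<Longrightarrow> b \<le> gamma TYPE('n)"
proof -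
  obtain a where a: "a \<in> cone_angles TYPE('n)" "\<forall>b\<in>cone_angles TYPE('n). b \<le> a"
    using ex_max_cone_angle[where 'n = 'n] by blast
  then have "gamma TYPE('n) = a"
    unfolding gamma_def by (intro Greatest_equality) auto
  with a show "gamma TYPE('n) \<in> cone_angles TYPE('n)"
    and "b \<in> cone_angles TYPE('n) \<Longrightarrow> b \<le> gamma TYPE('n)"
    by auto
qed

end

theory Submission
  imports Defs
begin

text \<open>Diagonalize \<open>Y\<close> in an orthonormal eigenbasis \<open>b\<close> with eigenvalues \<open>l b\<close>. Discarding the
  nonnegative terms of \<open>Tr(XY) = \<Sum>b. l b * (b \<bullet> X b)\<close> and applying Cauchy-Schwarz to the rest
  gives \<open>Tr(XY) \<ge> - |X| * sqrt (\<Sum>l b < 0. (l b)^2)\<close>, so it suffices that the negative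
  eigenvalues of \<open>Y\<close> carry at most half of \<open>|Y|^2\<close>. Since \<open>Y\<close> is entrywise nonnegative, its trace
  is nonnegative and its eigenvalue of largest modulus is nonnegative; for at most four eigenvalues
  these two facts suffice, by a majorization argument in the case of two negative ones.
  Equality holds for \<open>X = (e\<^sub>i - e\<^sub>j)(e\<^sub>i - e\<^sub>j)^T\<close> and \<open>Y = e\<^sub>i e\<^sub>j^T + e\<^sub>j e\<^sub>i^T\<close>.\<close>

section \<open>Spectral theorem for self-adjoint maps on an invariant subspace\<close>

text \<open>First-order optimality: \<open>g\<close> is nonnegative on \<open>S\<close> and vanishes
  at \<open>u\<close>, while its derivative at \<open>u\<close> in the direction of the residual
  \<open>v\<close> is \<open>2 * (v \<bullet> v)\<close>. A small step along \<open>- v\<close>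
  would make \<open>g\<close> negative unless \<open>v = 0\<close>.\<close>

lemma self_adjoint_max_eigenvector:
  fixes f :: "'a::euclidean_space \<Rightarrow> 'a"
  assumes lin: "linear f" and sa: "\<And>x y. x \<bullet> f y = f x \<bullet> y"
    and S: "subspace S" "f ` S \<subseteq> S" and u: "u \<in> S" "norm u = 1"
    and max: "\<And>x. x \<in> S \<Longrightarrow> norm x = 1 \<Longrightarrow> x \<bullet> f x \<le> u \<bullet> f u"
  shows "f u = (u \<bullet> f u) *\<^sub>R u"
proof -
  define m where "m = u \<bullet> f u"
  define v where "v = m *\<^sub>R u - f u"
  define g where "g x = m * (x \<bullet> x) - x \<bullet> f x" for x
  \<comment> \<open>Both terms of \<open>g\<close> are homogeneous of degree two, so maximality on
    the unit sphere carries over to all of \<open>S\<close>.\<close>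
  have g_nonneg: "0 \<le> g x" if "x \<in> S" for x
  proof (cases "x = 0")
    case True
    then show ?thesis by (simp add: g_def)
  next
    case False
    let ?y = "inverse (norm x) *\<^sub>R x"
    have "?y \<bullet> f ?y \<le> m"
      unfolding m_def using False that S(1) by (intro max) (auto simp: subspace_scale)
    moreover have "?y \<bullet> f ?y = (x \<bullet> f x) / (norm x)\<^sup>2"
      by (simp add: linear_scale[OF lin] power2_eq_square field_simps)
    ultimately show ?thesis
      using False by (simp add: g_def divide_le_eq power2_norm_eq_inner mult.commute)
  qed
  have vS: "v \<in> S"
    using S u unfolding v_def by (intro subspace_diff subspace_scale) auto
  have expand: "g (u + t *\<^sub>R v) = 2 * t * (v \<bullet> v) + t\<^sup>2 * g v" for t
  proof -
    have "f u = m *\<^sub>R u - v" by (simp add: v_def)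
    then have vfu: "v \<bullet> f u = m * (v \<bullet> u) - v \<bullet> v"
      by (simp add: inner_diff_right)
    have ufv: "u \<bullet> f v = m * (v \<bullet> u) - v \<bullet> v"
      using sa[of u v] vfu by (simp add: inner_commute)
    have uu: "u \<bullet> u = 1" using u(2) by (simp add: norm_eq_1)
    have "f (u + t *\<^sub>R v) = f u + t *\<^sub>R f v"
      by (simp add: linear_add[OF lin] linear_scale[OF lin])
    then show ?thesis
      by (simp add: g_def inner_add_left inner_add_right m_def[symmetric] vfu ufv uu inner_commute[of u v])
        (simp add: algebra_simps power2_eq_square)
  qed
  have quad: "0 \<le> 2 * t * (v \<bullet> v) + t\<^sup>2 * g v" for t
    using g_nonneg[of "u + t *\<^sub>R v"] S(1) u(1) vS expand
    by (simp add: subspace_add subspace_scale)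
  have "v \<bullet> v = 0"
  proof (rule ccontr)
    assume "v \<bullet> v \<noteq> 0"
    then have p: "0 < v \<bullet> v" by simp
    \<comment> \<open>The \<open>+ 1\<close> guards against \<open>g v = 0\<close>. With this
      \<open>t\<close>, the quadratic term at \<open>- t\<close> is at most half the size of the
      negative linear term.\<close>
    define t where "t = (v \<bullet> v) / (g v + 1)"
    have gv: "0 \<le> g v" using g_nonneg vS by blast
    then have t: "0 < t" using p by (simp add: t_def)
    have "t * g v \<le> v \<bullet> v"
      using gv p by (simp add: t_def field_simps)
    then have "t * (t * g v) \<le> t * (v \<bullet> v)"
      using t by simp
    moreover have "0 \<le> 2 * (- t) * (v \<bullet> v) + (- t)\<^sup>2 * g v" by (rule quad)
    moreover have "0 < t * (v \<bullet> v)" using t p by simp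
    ultimately show False by (simp add: power2_eq_square algebra_simps)
  qed
  then show ?thesis by (simp add: v_def m_def)
qed

text \<open>The bound on \<open>card B\<close> is carried along so that the number of eigenvalues is
  later bounded by the order of the matrix.\<close>

definition orthonormal_basis_of :: "'a::euclidean_space set \<Rightarrow> 'a set \<Rightarrow> bool" where
  "orthonormal_basis_of S B \<longleftrightarrow> finite B \<and> card B \<le> dim S \<and> B \<subseteq> S \<and>
     (\<forall>a\<in>B. \<forall>b\<in>B. a \<bullet> b = (if a = b then 1 else 0)) \<and>
     (\<forall>x\<in>S. (\<Sum>b\<in>B. (x \<bullet> b) *\<^sub>R b) = x)"

text \<open>Induction on the dimension: a maximizer of the quadratic form on the unit sphere of
  \<open>S\<close> is an eigenvector, and its orthogonal complement \<open>T\<close> within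
  \<open>S\<close> is again invariant and of smaller dimension.\<close>

lemma self_adjoint_eigenbasis_subspace:
  fixes f :: "'a::euclidean_space \<Rightarrow> 'a"
  assumes lin: "linear f" and sa: "\<And>x y. x \<bullet> f y = f x \<bullet> y"
    and "subspace S" "f ` S \<subseteq> S"
  shows "\<exists>B. orthonormal_basis_of S B \<and> (\<forall>b\<in>B. f b = (b \<bullet> f b) *\<^sub>R b)"
  using assms(3,4)
proof (induction "dim S" arbitrary: S rule: less_induct)
  case less
  note S = less.prems
  show ?case
  proof (cases "S \<subseteq> {0}")
    case True
    then show ?thesis
      by (intro exI[of _ "{}"]) (auto simp: orthonormal_basis_of_def)
  next
    case False
    then obtain z where z: "z \<in> S" "z \<noteq> 0" by blast
    let ?K = "S \<inter> sphere 0 1"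
    have "inverse (norm z) *\<^sub>R z \<in> ?K"
      using z S(1) by (auto simp: subspace_scale)
    moreover have "compact ?K"
      using S(1) by (simp add: closed_Int_compact closed_subspace)
    moreover have "continuous_on ?K (\<lambda>x. x \<bullet> f x)"
      using lin by (intro continuous_on_inner continuous_on_id linear_continuous_on)
        (simp add: linear_conv_bounded_linear)
    ultimately obtain u where "u \<in> ?K" "\<forall>x\<in>?K. x \<bullet> f x \<le> u \<bullet> f u"
      using continuous_attains_sup[of ?K "\<lambda>x. x \<bullet> f x"] by blast
    then have u: "u \<in> S" "norm u = 1"
      and max: "\<And>x. x \<in> S \<Longrightarrow> norm x = 1 \<Longrightarrow> x \<bullet> f x \<le> u \<bullet> f u"
      by auto
    have uu: "u \<bullet> u = 1" using u(2) by (simp add: norm_eq_1)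
    have eig: "f u = (u \<bullet> f u) *\<^sub>R u"
      using self_adjoint_max_eigenvector[OF lin sa S u max] .
    define T where "T = {x \<in> S. x \<bullet> u = 0}"
    have T: "subspace T"
      using S(1) by (auto simp: T_def subspace_def inner_add_left)
    have "f x \<in> T" if "x \<in> T" for x
    proof -
      have "f x \<bullet> u = x \<bullet> f u" using sa by simp
      also have "\<dots> = (u \<bullet> f u) * (x \<bullet> u)" by (subst eig) simp
      finally show ?thesis using that S(2) by (auto simp: T_def)
    qed
    then have fT: "f ` T \<subseteq> T" by blast
    have "u \<notin> T" using uu by (simp add: T_def)
    moreover have "T \<subseteq> S" by (auto simp: T_def)
    ultimately have "T \<subset> S" using u(1) by blast
    then have dim: "dim T < dim S"
      using T S(1) by (metis dim_psubset span_eq_iff)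
    obtain B where "orthonormal_basis_of T B" and fB: "\<forall>b\<in>B. f b = (b \<bullet> f b) *\<^sub>R b"
      using less.hyps[OF dim T fT] by blast
    then have B: "finite B" "card B \<le> dim T" "B \<subseteq> T"
        "\<And>a b. a \<in> B \<Longrightarrow> b \<in> B \<Longrightarrow> a \<bullet> b = (if a = b then 1 else 0)"
        "\<And>x. x \<in> T \<Longrightarrow> (\<Sum>b\<in>B. (x \<bullet> b) *\<^sub>R b) = x"
      by (auto simp: orthonormal_basis_of_def)
    have perp: "b \<bullet> u = 0" "u \<bullet> b = 0" if "b \<in> B" for b
      using that B(3) by (auto simp: T_def inner_commute)
    have uB: "u \<notin> B" using perp uu by force
    have "(\<Sum>b\<in>insert u B. (x \<bullet> b) *\<^sub>R b) = x" if "x \<in> S" for x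
    proof -
      \<comment> \<open>Removing the component along \<open>u\<close> lands in \<open>T\<close>,
        where the expansion from the induction hypothesis applies.\<close>
      let ?y = "x - (x \<bullet> u) *\<^sub>R u"
      have "?y \<in> T"
        using that S(1) u(1) uu by (auto simp: T_def subspace_diff subspace_scale inner_diff_left)
      then have "?y = (\<Sum>b\<in>B. (?y \<bullet> b) *\<^sub>R b)" using B(5) by simp
      also have "\<dots> = (\<Sum>b\<in>B. (x \<bullet> b) *\<^sub>R b)"
        by (intro sum.cong) (auto simp: inner_diff_left perp)
      finally show ?thesis using B(1) uB by (simp add: algebra_simps)
    qed
    moreover have "\<forall>a\<in>insert u B. \<forall>b\<in>insert u B. a \<bullet> b = (if a = b then 1 else 0)"
      using B(4) perp uu uB by auto
    moreover have "insert u B \<subseteq> S" using u B(3) by (auto simp: T_def)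
    moreover have "card (insert u B) \<le> dim S" using B(1,2) uB dim by simp
    ultimately show ?thesis
      using B(1) eig fB by (intro exI[of _ "insert u B"]) (auto simp: orthonormal_basis_of_def)
  qed
qed

lemma inner_symmetric_matrix:
  fixes A :: "real^'n^'n"
  assumes "transpose A = A"
  shows "x \<bullet> (A *v y) = (A *v x) \<bullet> y"
  by (simp add: dot_lmul_matrix[symmetric] transpose_matrix_vector[of A x, unfolded assms])

lemma symmetric_matrix_eigenbasis:
  fixes A :: "real^'n^'n"
  assumes "transpose A = A"
  shows "\<exists>B. orthonormal_basis_of UNIV B \<and> (\<forall>b\<in>B. A *v b = (b \<bullet> (A *v b)) *\<^sub>R b)"
  using self_adjoint_eigenbasis_subspace[of "\<lambda>x. A *v x" UNIV] inner_symmetric_matrix[OF assms]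
  by simp

section \<open>Inner products, traces and quadratic forms in an orthonormal basis\<close>

text \<open>Parseval's identity.\<close>

lemma orthonormal_basis_inner:
  assumes "orthonormal_basis_of UNIV B"
  shows "(\<Sum>b\<in>B. (x \<bullet> b) * (y \<bullet> b)) = x \<bullet> y"
proof -
  have "x \<bullet> y = (\<Sum>b\<in>B. (x \<bullet> b) *\<^sub>R b) \<bullet> y"
    using assms by (simp add: orthonormal_basis_of_def)
  also have "\<dots> = (\<Sum>b\<in>B. (x \<bullet> b) * (y \<bullet> b))"
    unfolding inner_sum_left inner_scaleR_left by (simp add: inner_commute)
  finally show ?thesis by simp
qed

lemma trace_orthonormal_basis:
  fixes A :: "real^'n^'n"
  assumes "orthonormal_basis_of UNIV B"
  shows "trace A = (\<Sum>b\<in>B. b \<bullet> (A *v b))"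
proof -
  \<comment> \<open>Completeness relation: Parseval's identity for two coordinate vectors. It makes
    the trace independent of the orthonormal basis.\<close>
  have delta: "(\<Sum>b\<in>B. b $ i * b $ j) = (if i = j then 1 else 0)" for i j
  proof -
    have "axis i 1 \<bullet> (axis j 1 :: real^'n) = (if i = j then 1 else 0)"
      by (simp add: inner_axis_axis)
    then show ?thesis
      using orthonormal_basis_inner[OF assms, of "axis i 1" "axis j 1"] by (simp add: inner_axis')
  qed
  have "(\<Sum>b\<in>B. b \<bullet> (A *v b)) = (\<Sum>b\<in>B. \<Sum>i\<in>UNIV. \<Sum>j\<in>UNIV. A $ i $ j * (b $ i * b $ j))"
    by (simp add: inner_vec_def matrix_vector_mult_def sum_distrib_left mult_ac)
  also have "\<dots> = (\<Sum>i\<in>UNIV. \<Sum>j\<in>UNIV. \<Sum>b\<in>B. A $ i $ j * (b $ i * b $ j))"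
    by (subst sum.swap, rule sum.cong[OF refl], rule sum.swap)
  also have "\<dots> = trace A"
    by (simp add: sum_distrib_left[symmetric] delta trace_def if_distrib[of "(*) _"] cong: if_cong)
  finally show ?thesis ..
qed

text \<open>Perron-Frobenius in Rayleigh-quotient form: passing from an eigenvector to its entrywise
  absolute value can only increase the quadratic form.\<close>

lemma nonneg_matrix_dominant_eigenvalue:
  fixes Y :: "real^'n^'n"
  assumes Y: "\<And>i j. 0 \<le> Y $ i $ j" and B: "orthonormal_basis_of UNIV B"
    and eig: "\<And>b. b \<in> B \<Longrightarrow> Y *v b = (b \<bullet> (Y *v b)) *\<^sub>R b"
    and le: "\<And>b. b \<in> B \<Longrightarrow> b \<bullet> (Y *v b) \<le> m" and b: "b \<in> B"
  shows "\<bar>b \<bullet> (Y *v b)\<bar> \<le> m"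
proof -
  define v :: "real^'n" where "v = (\<chi> i. \<bar>b $ i\<bar>)"
  have "\<bar>b \<bullet> (Y *v b)\<bar> \<le> v \<bullet> (Y *v v)"
  proof -
    have "\<bar>b \<bullet> (Y *v b)\<bar> = \<bar>\<Sum>i\<in>UNIV. \<Sum>j\<in>UNIV. b $ i * (Y $ i $ j * b $ j)\<bar>"
      by (simp add: inner_vec_def matrix_vector_mult_def sum_distrib_left)
    also have "\<dots> \<le> (\<Sum>i\<in>UNIV. \<Sum>j\<in>UNIV. \<bar>b $ i * (Y $ i $ j * b $ j)\<bar>)"
      by (intro order_trans[OF sum_abs] sum_mono) simp
    also have "\<dots> = v \<bullet> (Y *v v)"
      using Y by (simp add: inner_vec_def matrix_vector_mult_def sum_distrib_left v_def abs_mult)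
    finally show ?thesis .
  qed
  also have "v \<bullet> (Y *v v) \<le> m"
  proof -
    have "b \<bullet> b = 1" using B b by (auto simp: orthonormal_basis_of_def)
    then have "v \<bullet> v = 1" by (simp add: v_def inner_vec_def)
    have "Y *v v = Y *v (\<Sum>b\<in>B. (v \<bullet> b) *\<^sub>R b)"
      using B by (simp add: orthonormal_basis_of_def)
    also have "\<dots> = (\<Sum>b\<in>B. (v \<bullet> b) *\<^sub>R (Y *v b))"
      by (simp add: linear_sum[OF matrix_vector_mul_linear] linear_scale[OF matrix_vector_mul_linear])
    finally have "v \<bullet> (Y *v v) = (\<Sum>b\<in>B. (v \<bullet> b) * (v \<bullet> (Y *v b)))"
      by (simp add: inner_sum_right)
    also have "\<dots> = (\<Sum>b\<in>B. (b \<bullet> (Y *v b)) * (v \<bullet> b)\<^sup>2)"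
    proof (intro sum.cong refl)
      fix c assume "c \<in> B"
      have "v \<bullet> (Y *v c) = (c \<bullet> (Y *v c)) * (v \<bullet> c)"
        by (subst eig[OF \<open>c \<in> B\<close>]) simp
      then show "(v \<bullet> c) * (v \<bullet> (Y *v c)) = (c \<bullet> (Y *v c)) * (v \<bullet> c)\<^sup>2"
        by (simp add: power2_eq_square)
    qed
    \<comment> \<open>The Rayleigh quotient at \<open>v\<close> is an average of the eigenvalues,
      since by Parseval's identity the weights add up to \<open>v \<bullet> v = 1\<close>.\<close>
    also have "\<dots> \<le> (\<Sum>b\<in>B. m * (v \<bullet> b)\<^sup>2)"
      using le by (intro sum_mono mult_right_mono) auto
    also have "\<dots> = m"
      using orthonormal_basis_inner[OF B, of v v] \<open>v \<bullet> v = 1\<close>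
      by (simp add: sum_distrib_left[symmetric] power2_eq_square)
    finally show ?thesis .
  qed
  finally show ?thesis .
qed

section \<open>Squares of negative and nonnegative values among at most four numbers\<close>

lemma sum_power2_le_power2_sum:
  fixes f :: "'a \<Rightarrow> real"
  assumes "\<And>x. x \<in> A \<Longrightarrow> 0 \<le> f x"
  shows "(\<Sum>x\<in>A. (f x)\<^sup>2) \<le> (\<Sum>x\<in>A. f x)\<^sup>2"
  using assms
proof (induction A rule: infinite_finite_induct)
  case (insert x A)
  then have "0 \<le> f x * sum f A" by (simp add: sum_nonneg)
  with insert show ?case by (simp add: power2_sum)
qed auto

text \<open>At most three values remain besides the dominant \<open>f a\<close>. Without a further
  nonnegative value, the sum condition bounds the total of the negative moduli by
  \<open>f a\<close>; with at most one negative value, domination by \<open>f a\<close> is enough.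
  There remains the case of two negative values against \<open>f a\<close> and one other.\<close>

lemma sum_squares_negative_le_nonnegative:
  fixes f :: "'a \<Rightarrow> real"
  assumes fin: "finite B" and card: "card B \<le> 4" and a: "a \<in> B"
    and dom: "\<And>b. b \<in> B \<Longrightarrow> \<bar>f b\<bar> \<le> f a" and sum: "0 \<le> sum f B"
  shows "(\<Sum>b | b \<in> B \<and> f b < 0. (f b)\<^sup>2) \<le> (\<Sum>b | b \<in> B \<and> \<not> f b < 0. (f b)\<^sup>2)"
proof -
  define N where "N = {b \<in> B. f b < 0}"
  define P where "P = {b \<in> B. \<not> f b < 0} - {a}"
  have fa: "0 \<le> f a" using dom[OF a] by linarith
  have ins: "{b \<in> B. \<not> f b < 0} = insert a P" "a \<notin> P"
    using a fa by (auto simp: P_def)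
  have fins: "finite N" "finite P" using fin by (auto simp: N_def P_def)
  have B: "B = insert a (N \<union> P)" using ins by (auto simp: N_def)
  have disj: "N \<inter> P = {}" "a \<notin> N" using fa by (auto simp: N_def P_def)
  have cards: "card N + card P \<le> 3"
    using card fins disj ins(2) by (simp add: B card_Un_disjoint)
  have sum': "(\<Sum>b\<in>N. - f b) \<le> f a + sum f P"
    using sum fins disj ins(2) by (simp add: B sum.union_disjoint sum_negf)
  have domN: "0 < - f b" "- f b \<le> f a" if "b \<in> N" for b
    using that dom[of b] by (auto simp: N_def)
  have domP: "0 \<le> f b" if "b \<in> P" for b
    using that by (auto simp: P_def)
  have "(\<Sum>b\<in>N. (f b)\<^sup>2) \<le> (f a)\<^sup>2 + (\<Sum>b\<in>P. (f b)\<^sup>2)"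
  proof -
    consider "card P = 0" | "card N \<le> 1" | "card P = 1" "card N = 2"
      using cards by linarith
    then show ?thesis
    proof cases
      case 1
      then have "P = {}" using fins by simp
      have "(\<Sum>b\<in>N. (f b)\<^sup>2) = (\<Sum>b\<in>N. (- f b)\<^sup>2)" by simp
      also have "\<dots> \<le> (\<Sum>b\<in>N. - f b)\<^sup>2"
        using domN by (intro sum_power2_le_power2_sum) force
      also have "\<dots> \<le> (f a)\<^sup>2"
        using sum' \<open>P = {}\<close> domN by (intro power_mono sum_nonneg) force+
      finally show ?thesis using \<open>P = {}\<close> by simp
    next
      case 2
      have "(\<Sum>b\<in>N. (f b)\<^sup>2) \<le> (\<Sum>b\<in>N. (f a)\<^sup>2)"
      proof (intro sum_mono)
        fix b assume "b \<in> N"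
        then show "(f b)\<^sup>2 \<le> (f a)\<^sup>2"
          using power_mono[of "- f b" "f a" 2] domN[of b] by simp
      qed
      also have "\<dots> \<le> (f a)\<^sup>2"
        using 2 by (cases "card N") auto
      finally show ?thesis by (simp add: sum_nonneg add_increasing2)
    next
      case 3
      then obtain p n n' where "P = {p}" "N = {n, n'}" "n \<noteq> n'"
        by (auto simp: card_1_singleton_iff card_2_iff)
      then have *: "- f n - f n' \<le> f a + f p" "- f n \<le> f a" "- f n' \<le> f a" "0 \<le> f p"
          "0 < - f n" "0 < - f n'"
        using sum' domN domP by auto
      \<comment> \<open>The pair \<open>(x, y)\<close> is weakly majorized by
        \<open>(f a, f p)\<close>, and the sum of squares respects this order on nonnegative
        pairs.\<close>
      have key: "x\<^sup>2 + y\<^sup>2 \<le> (f a)\<^sup>2 + (f p)\<^sup>2"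
        if xy: "0 \<le> y" "y \<le> x" "x \<le> f a" "x + y \<le> f a + f p" for x y
      proof (cases "y \<le> f p")
        case True
        then show ?thesis using xy by (intro add_mono power_mono) auto
      next
        case False
        \<comment> \<open>Here both \<open>x\<close> and \<open>y\<close> exceed \<open>f p\<close>.
          Replacing them by \<open>x + y - f p\<close> and \<open>f p\<close> keeps the sum, spreads
          the pair and adds exactly twice this product to the sum of squares.\<close>
        have "0 \<le> (x - f p) * (y - f p)" using False xy by simp
        then have "x\<^sup>2 + y\<^sup>2 \<le> (x + y - f p)\<^sup>2 + (f p)\<^sup>2"
          by (simp add: power2_eq_square algebra_simps)
        also have "(x + y - f p)\<^sup>2 \<le> (f a)\<^sup>2"
          using False xy by (intro power_mono) auto
        finally show ?thesis by simp
      qed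
      have "(- f n)\<^sup>2 + (- f n')\<^sup>2 \<le> (f a)\<^sup>2 + (f p)\<^sup>2"
        using key[of "- f n'" "- f n"] key[of "- f n" "- f n'"] *
        by (cases "- f n' \<le> - f n") auto
      then show ?thesis
        using \<open>P = {p}\<close> \<open>N = {n, n'}\<close> \<open>n \<noteq> n'\<close> by simp
    qed
  qed
  then show ?thesis
    using ins fins by (simp add: N_def)
qed

section \<open>The lower bound on the trace\<close>

lemma norm_symmetric_matrix_orthonormal_basis:
  fixes A :: "real^'n^'n"
  assumes A: "transpose A = A" and B: "orthonormal_basis_of UNIV B"
  shows "(norm A)\<^sup>2 = (\<Sum>b\<in>B. (norm (A *v b))\<^sup>2)"
proof -
  have "(norm A)\<^sup>2 = trace (A ** A)"
    by (simp add: trace_eq_inner[OF A] power2_norm_eq_inner)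
  also have "\<dots> = (\<Sum>b\<in>B. b \<bullet> (A *v (A *v b)))"
    by (simp add: trace_orthonormal_basis[OF B] matrix_vector_mul_assoc)
  also have "\<dots> = (\<Sum>b\<in>B. (norm (A *v b))\<^sup>2)"
    by (simp add: inner_symmetric_matrix[OF A] power2_norm_eq_inner)
  finally show ?thesis .
qed

lemma psd_nonneg_trace_bound:
  fixes X Y :: "real^'n^'n"
  assumes n: "CARD('n) \<le> 4" and X: "X \<in> psd_cone" and Y: "Y \<in> nonneg_cone"
  shows "- (sqrt 2 / 2 * (norm X * norm Y)) \<le> trace (X ** Y)"
proof -
  have sX: "transpose X = X" and pX: "\<And>x. 0 \<le> x \<bullet> (X *v x)"
    using X by (auto simp: psd_cone_def)
  have sY: "transpose Y = Y" and pY: "\<And>i j. 0 \<le> Y $ i $ j"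
    using Y by (auto simp: nonneg_cone_def)
  obtain B where B: "orthonormal_basis_of UNIV B"
    and eig: "\<And>b. b \<in> B \<Longrightarrow> Y *v b = (b \<bullet> (Y *v b)) *\<^sub>R b"
    using symmetric_matrix_eigenbasis[OF sY] by blast
  have fin: "finite B" and card: "card B \<le> 4" and unit: "\<And>b. b \<in> B \<Longrightarrow> norm b = 1"
    using B n by (auto simp: orthonormal_basis_of_def norm_eq_1)
  define l where "l b = b \<bullet> (Y *v b)" for b
  define q where "q b = b \<bullet> (X *v b)" for b
  define N where "N = {b \<in> B. l b < 0}"
  have NB: "N \<subseteq> B" by (auto simp: N_def)
  have tr: "trace (X ** Y) = (\<Sum>b\<in>B. l b * q b)"
  proof -
    have "b \<bullet> (X *v (Y *v b)) = l b * q b" if "b \<in> B" for b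
      by (subst eig[OF that])
        (simp add: l_def q_def linear_scale[OF matrix_vector_mul_linear])
    then show ?thesis
      by (simp add: trace_orthonormal_basis[OF B] matrix_vector_mul_assoc[symmetric])
  qed
  have normY: "(norm Y)\<^sup>2 = (\<Sum>b\<in>B. (l b)\<^sup>2)"
  proof -
    have "norm (Y *v b) = \<bar>l b\<bar>" if "b \<in> B" for b
      by (subst eig[OF that]) (simp add: l_def unit that)
    then show ?thesis
      by (simp add: norm_symmetric_matrix_orthonormal_basis[OF sY B])
  qed
  \<comment> \<open>The \<open>q b\<close> are the diagonal entries of \<open>X\<close> in the basis
    \<open>B\<close>, and the Frobenius norm of \<open>X\<close> is the same in every orthonormal
    basis.\<close>
  have normX: "(\<Sum>b\<in>N. (q b)\<^sup>2) \<le> (norm X)\<^sup>2"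
  proof -
    have "(\<Sum>b\<in>N. (q b)\<^sup>2) \<le> (\<Sum>b\<in>B. (q b)\<^sup>2)"
      using fin NB by (intro sum_mono2) auto
    also have "\<dots> \<le> (\<Sum>b\<in>B. (norm (X *v b))\<^sup>2)"
    proof (intro sum_mono)
      fix b assume "b \<in> B"
      then show "(q b)\<^sup>2 \<le> (norm (X *v b))\<^sup>2"
        using Cauchy_Schwarz_ineq2[of b "X *v b"] unit[of b]
        by (simp add: q_def abs_le_square_iff[symmetric])
    qed
    finally show ?thesis
      by (simp add: norm_symmetric_matrix_orthonormal_basis[OF sX B])
  qed
  have half: "2 * (\<Sum>b\<in>N. (l b)\<^sup>2) \<le> (norm Y)\<^sup>2"
  proof (cases "B = {}")
    case True
    then show ?thesis by (simp add: N_def)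
  next
    case False
    then obtain a where a: "a \<in> B" "\<And>b. b \<in> B \<Longrightarrow> l b \<le> l a"
      using finite_has_maximal[of "l ` B"] fin by force
    \<comment> \<open>\<open>a\<close> was chosen for the largest signed eigenvalue; nonnegativity
      of the entries of \<open>Y\<close> makes it the largest in modulus as well.\<close>
    have "\<bar>l b\<bar> \<le> l a" if "b \<in> B" for b
      using nonneg_matrix_dominant_eigenvalue[OF pY B eig, of "l a" b] a(2) that
      by (simp add: l_def)
    moreover have "0 \<le> sum l B"
    proof -
      have "0 \<le> trace Y" by (simp add: trace_def sum_nonneg pY)
      also have "trace Y = sum l B"
        by (simp add: trace_orthonormal_basis[OF B] l_def)
      finally show ?thesis .
    qed
    ultimately have "(\<Sum>b\<in>N. (l b)\<^sup>2) \<le> (\<Sum>b | b \<in> B \<and> \<not> l b < 0. (l b)\<^sup>2)"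
      unfolding N_def using sum_squares_negative_le_nonnegative[OF fin card a(1)] by blast
    moreover have "{b \<in> B. \<not> l b < 0} = B - N" by (auto simp: N_def)
    ultimately show ?thesis
      using sum.subset_diff[OF NB fin, of "\<lambda>b. (l b)\<^sup>2"] normY by simp
  qed
  \<comment> \<open>The factor \<open>sqrt 2 / 2\<close> is the square root of the share 1/2 of the
    squared norm of \<open>Y\<close> granted by \<open>half\<close>.\<close>
  have "\<bar>\<Sum>b\<in>N. l b * q b\<bar> \<le> sqrt 2 / 2 * (norm X * norm Y)"
  proof (rule power2_le_imp_le)
    have "\<bar>\<Sum>b\<in>N. l b * q b\<bar>\<^sup>2 \<le> (\<Sum>b\<in>N. (l b)\<^sup>2) * (\<Sum>b\<in>N. (q b)\<^sup>2)"
      using Cauchy_Schwarz_ineq_sum by simp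
    also have "\<dots> \<le> ((norm Y)\<^sup>2 / 2) * (norm X)\<^sup>2"
      using half normX by (intro mult_mono) (auto simp: sum_nonneg)
    also have "\<dots> = (sqrt 2 / 2 * (norm X * norm Y))\<^sup>2"
      by (simp add: power_mult_distrib power_divide)
    finally show "\<bar>\<Sum>b\<in>N. l b * q b\<bar>\<^sup>2 \<le> (sqrt 2 / 2 * (norm X * norm Y))\<^sup>2" .
  qed simp
  \<comment> \<open>Each added term has \<open>l b\<close> nonnegative, because \<open>b\<close>
    lies outside \<open>N\<close>, and \<open>q b\<close> nonnegative, because \<open>X\<close> is
    positive semidefinite.\<close>
  moreover have "(\<Sum>b\<in>N. l b * q b) \<le> (\<Sum>b\<in>B. l b * q b)"
    using fin NB pX by (intro sum_mono2) (auto simp: N_def q_def)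
  ultimately show ?thesis using tr by linarith
qed

section \<open>From the trace bound to the angle, and its attainment\<close>

lemma arccos_minus_sqrt2_half: "arccos (- (sqrt 2 / 2)) = 3 / 4 * pi"
proof -
  have "cos (3 / 4 * pi) = - cos (pi / 4)"
    using cos_minus_pi[of "pi / 4"] cos_minus[of "pi / 4 - pi"] by (simp add: field_simps)
  then have "cos (3 / 4 * pi) = - (sqrt 2 / 2)" by (simp add: cos_45)
  then show ?thesis using arccos_cos[of "3 / 4 * pi"] by simp
qed

lemma mat_angle_le:
  fixes X Y :: "real^'n^'n"
  assumes "CARD('n) \<le> 4" and X: "X \<in> psd_cone" "X \<noteq> 0" and Y: "Y \<in> nonneg_cone" "Y \<noteq> 0"
  shows "mat_angle X Y \<le> 3 / 4 * pi"
proof -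
  have pos: "0 < norm X * norm Y" using X Y by simp
  have tr: "trace (X ** Y) = X \<bullet> Y"
    using Y by (intro trace_eq_inner) (simp add: nonneg_cone_def)
  have "- (sqrt 2 / 2) \<le> trace (X ** Y) / (norm X * norm Y)"
    using psd_nonneg_trace_bound[OF assms(1) X(1) Y(1)] pos by (simp add: le_divide_eq)
  \<comment> \<open>This bound and the next keep both arguments in the interval from -1 to 1, where
    \<open>arccos\<close> is decreasing.\<close>
  moreover have "trace (X ** Y) / (norm X * norm Y) \<le> 1"
    using pos tr norm_cauchy_schwarz[of X Y] by (simp add: divide_le_eq)
  moreover have "sqrt 2 / 2 \<le> 1"
    by (simp add: real_le_lsqrt real_sqrt_le_iff)
  ultimately have "mat_angle X Y \<le> arccos (- (sqrt 2 / 2))"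
    unfolding mat_angle_def by (intro arccos_le_arccos) auto
  then show ?thesis by (simp add: arccos_minus_sqrt2_half)
qed

text \<open>Every estimate of the upper bound is sharp here: the nonzero eigenvalues of
  \<open>Y\<close> are 1 and -1, so the negative one carries exactly half of the squared norm, and
  \<open>X\<close> is a multiple of the projection onto its eigenvector \<open>v\<close>.\<close>

lemma three_quarters_pi_in_cone_angles:
  assumes "2 \<le> CARD('n::finite)"
  shows "3 / 4 * pi \<in> cone_angles TYPE('n)"
proof -
  obtain i j :: 'n where ij: "i \<noteq> j"
    using assms card_le_Suc0_iff_eq[of "UNIV :: 'n set"] by force
  define v :: "real^'n" where "v = axis i 1 - axis j 1"
  define X :: "real^'n^'n" where "X = (\<chi> r s. v $ r * v $ s)"
  define Y :: "real^'n^'n" where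
    "Y = (\<chi> r s. if r = i \<and> s = j \<or> r = j \<and> s = i then 1 else 0)"
  have rowX: "X $ r = v $ r *\<^sub>R v" for r
    by (simp add: X_def vec_eq_iff)
  have rowY: "Y $ r = (if r = i then axis j 1 else if r = j then axis i 1 else 0)" for r
    using ij by (simp add: Y_def vec_eq_iff axis_def)
  have vv: "v \<bullet> v = 2"
    using ij by (simp add: v_def inner_diff_left inner_diff_right inner_axis_axis)
  have vec: "v $ i = 1" "v $ j = -1" using ij by (auto simp: v_def axis_def)
  have "X \<bullet> X = (\<Sum>r\<in>UNIV. (v $ r * v $ r) * (v \<bullet> v))"
    by (subst inner_vec_def) (simp add: rowX mult_ac)
  also have "\<dots> = (v \<bullet> v) * (v \<bullet> v)"
    by (simp add: inner_vec_def[of v v] sum_distrib_right)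
  finally have nX: "norm X = 2" by (simp add: norm_eq_sqrt_inner vv)
  \<comment> \<open>Only rows \<open>i\<close> and \<open>j\<close> of \<open>Y\<close> are nonzero,
    so the row sums below reduce to two terms.\<close>
  have two: "(\<Sum>r\<in>UNIV. h r) = h i + h j" if "\<And>r. r \<noteq> i \<Longrightarrow> r \<noteq> j \<Longrightarrow> h r = 0"
    for h :: "'n \<Rightarrow> real"
  proof -
    have "sum h UNIV = sum h {i, j}"
      using that by (intro sum.mono_neutral_right) auto
    then show ?thesis using ij by simp
  qed
  have "Y \<bullet> Y = 2"
    using ij by (subst inner_vec_def, subst two) (auto simp: rowY inner_axis_axis)
  then have nY: "norm Y = sqrt 2" by (simp add: norm_eq_sqrt_inner)
  have XY: "X \<bullet> Y = -2"
    using ij by (subst inner_vec_def, subst two) (auto simp: rowX rowY inner_axis vec)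
  have symY: "transpose Y = Y" by (auto simp: transpose_def Y_def vec_eq_iff)
  \<comment> \<open>Hence the quadratic form of \<open>X\<close> at \<open>x\<close> is the square
    of \<open>v \<bullet> x\<close>.\<close>
  have Xv: "X *v x = (v \<bullet> x) *\<^sub>R v" for x
    by (simp add: X_def matrix_vector_mult_def inner_vec_def vec_eq_iff sum_distrib_left mult_ac)
  have "transpose X = X" by (simp add: transpose_def X_def vec_eq_iff mult.commute)
  then have "X \<in> psd_cone" by (simp add: psd_cone_def Xv inner_commute)
  moreover have "Y \<in> nonneg_cone" using symY by (simp add: nonneg_cone_def Y_def)
  moreover have "X \<noteq> 0" "Y \<noteq> 0" using nX nY by auto
  moreover have "mat_angle X Y = arccos (- (sqrt 2 / 2))"
  proof -
    have "-2 / (2 * sqrt 2) = - (sqrt 2 / 2)" by (simp add: field_simps)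
    then show ?thesis by (simp only: mat_angle_def trace_eq_inner[OF symY] nX nY XY)
  qed
  ultimately show ?thesis
    unfolding cone_angles_def arccos_minus_sqrt2_half[symmetric] by force
qed

theorem theorem2p7:
  assumes "2 \<le> CARD('n::finite)" and "CARD('n) \<le> 4"
  shows "gamma TYPE('n) = 3 / 4 * pi"
proof (rule antisym)
  show "gamma TYPE('n) \<le> 3 / 4 * pi"
    using gamma_is_max(1)[where 'n = 'n] mat_angle_le[OF assms(2)]
    by (auto simp: cone_angles_def)
  show "3 / 4 * pi \<le> gamma TYPE('n)"
    using gamma_is_max(2) three_quarters_pi_in_cone_angles[OF assms(1)] .
qed

end
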